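(* Let $\Omega_1\subset\mathbb{C}^n$ and $\Omega_2\subset\mathbb{C}^m$ be bounded domains. If $\varphi: E(\Omega_1)\rightarrow E(\Omega_2)$ is an epimorphism of semigroups, then $\varphi$ is an isomorphism.
   Context: For a bounded domain $\Omega$ in $\mathbb{C}^n$, $E(\Omega)$ denotes the semigroup, under composition, of all analytic (holomorphic) endomorphisms of $\Omega$, i.e. of all holomorphic maps $f:\Omega\to\Omega$. An epimorphism of semigroups means a surjective semigroup homomorphism; an isomorphism is a bijective semigroup homomorphism. *)

theory Defs
  imports "HOL-Analysis.Analysis" "HOL-Algebra.Group"
begin

definition bounded_domain :: "(complex ^ 'n) set \<Rightarrow> bool" where
  "bounded_domain \<Omega> \<longleftrightarrow> open \<Omega> \<and> connected \<Omega> \<and> \<Omega> \<noteq> {} \<and> bounded \<Omega>"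

text \<open>
  Holomorphy in several variables, for open \<open>\<Omega>\<close>: at every point the map has a Frechet
  derivative (real linear, by definition of \<^const>\<open>has_derivative\<close>) that is linear over
  the complex numbers.
\<close>

definition holomorphic_map_on ::
    "(complex ^ 'n) set \<Rightarrow> (complex ^ 'n \<Rightarrow> complex ^ 'm) \<Rightarrow> bool" where
  "holomorphic_map_on \<Omega> f \<longleftrightarrow>
     (\<forall>z\<in>\<Omega>. \<exists>f'. (f has_derivative f') (at z) \<and> Vector_Spaces.linear (*s) (*s) f')"

text \<open>
  Elements are extensional functions, so that two maps agreeing on \<open>\<Omega>\<close> are equal;
  the product of \<open>g\<close> and \<open>f\<close> is \<open>g\<close> after \<open>f\<close>, restricted to \<open>\<Omega>\<close>.
  \<^const>\<open>hom\<close>, \<^const>\<open>epi\<close> and \<^const>\<open>iso\<close> only refer to the carrier and the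
  product, so they are the morphisms of semigroups; the unit plays no role in them.
\<close>

definition holo_End :: "(complex ^ 'n) set \<Rightarrow> (complex ^ 'n \<Rightarrow> complex ^ 'n) monoid" where
  "holo_End \<Omega> =
     \<lparr>carrier = {f \<in> \<Omega> \<rightarrow>\<^sub>E \<Omega>. holomorphic_map_on \<Omega> f},
      mult = compose \<Omega>,
      one = (\<lambda>z\<in>\<Omega>. z)\<rparr>"

lemma holomorphic_map_on_cong:
  assumes "open \<Omega>" "\<And>z. z \<in> \<Omega> \<Longrightarrow> f z = g z" "holomorphic_map_on \<Omega> f"
  shows "holomorphic_map_on \<Omega> g"
  using assms unfolding holomorphic_map_on_def
  by (meson has_derivative_transform_within_open)

lemma holomorphic_map_on_compose:
  assumes f: "holomorphic_map_on \<Omega> f" "f \<in> \<Omega> \<rightarrow> \<Omega>'" and g: "holomorphic_map_on \<Omega>' g"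
  shows "holomorphic_map_on \<Omega> (g \<circ> f)"
  unfolding holomorphic_map_on_def
proof
  fix z assume z: "z \<in> \<Omega>"
  then obtain f' where f': "(f has_derivative f') (at z)" "Vector_Spaces.linear (*s) (*s) f'"
    using f unfolding holomorphic_map_on_def by blast
  obtain g' where g': "(g has_derivative g') (at (f z))" "Vector_Spaces.linear (*s) (*s) g'"
    using f g z unfolding holomorphic_map_on_def by blast
  have "((g \<circ> f) has_derivative (g' \<circ> f')) (at z)"
    using f' g' by (intro diff_chain_at)
  moreover have "Vector_Spaces.linear (*s) (*s) (g' \<circ> f')"
    using f' g' by (intro Vector_Spaces.linear_compose)
  ultimately show "\<exists>h'. ((g \<circ> f) has_derivative h') (at z) \<and> Vector_Spaces.linear (*s) (*s) h'"
    by blast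
qed

lemma monoid_holo_End:
  assumes "open \<Omega>"
  shows "monoid (holo_End \<Omega>)"
proof (rule monoidI)
  have "holomorphic_map_on \<Omega> (\<lambda>z. z)"
    unfolding holomorphic_map_on_def by (metis has_derivative_ident vec.linear_ident)
  then have "holomorphic_map_on \<Omega> (\<lambda>z\<in>\<Omega>. z)"
    by (rule holomorphic_map_on_cong[OF assms, rotated]) simp
  then show "\<one>\<^bsub>holo_End \<Omega>\<^esub> \<in> carrier (holo_End \<Omega>)"
    by (simp add: holo_End_def)
next
  fix g f assume gf: "g \<in> carrier (holo_End \<Omega>)" "f \<in> carrier (holo_End \<Omega>)"
  then have "holomorphic_map_on \<Omega> (g \<circ> f)"
    by (intro holomorphic_map_on_compose[of \<Omega> f \<Omega> g]) (auto simp: holo_End_def)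
  then have "holomorphic_map_on \<Omega> (compose \<Omega> g f)"
    by (rule holomorphic_map_on_cong[OF assms, rotated]) (simp add: compose_def)
  moreover have "compose \<Omega> g f \<in> \<Omega> \<rightarrow>\<^sub>E \<Omega>"
    using gf by (auto simp: holo_End_def compose_def)
  ultimately show "g \<otimes>\<^bsub>holo_End \<Omega>\<^esub> f \<in> carrier (holo_End \<Omega>)"
    by (simp add: holo_End_def)
qed (auto simp: holo_End_def compose_def fun_eq_iff PiE_iff extensional_def Pi_iff)

end

theory Submission
  imports Defs
begin

text \<open>
  The constant endomorphisms are exactly the left zeros of the semigroup (\<open>c f = c\<close> for all \<open>f\<close>),
  and an epimorphism preserves left zeros. So \<open>\<phi>\<close> induces a point map \<open>\<psi>\<close> of \<open>\<Omega>1\<close> onto \<open>\<Omega>2\<close>,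
  and applying \<open>\<phi>\<close> to the identity \<open>f \<circ> const z = const (f z)\<close> gives \<open>\<phi> f \<circ> \<psi> = \<psi> \<circ> f\<close>.
  If \<open>\<psi>\<close> is injective then \<open>\<phi> f\<close> determines \<open>\<psi> \<circ> f\<close> and hence \<open>f\<close>, so the theorem comes down to
  the injectivity of \<open>\<psi>\<close>.

  The intertwining relation makes the fibres of \<open>\<psi>\<close> the classes of an equivalence relation on
  \<open>\<Omega>1\<close> that is invariant under all of \<open>E(\<Omega>1)\<close>, and such a relation is
  either equality or has a single class (lemma
  \<open>invariant_map_injective_or_constant\<close>). For if two points \<open>a \<noteq> b\<close> are equivalent, then so are
  \<open>f a\<close> and \<open>f b\<close> for every endomorphism \<open>f\<close>; as \<open>\<Omega>1\<close> is bounded, there are enough affine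
  endomorphisms to carry \<open>(a, b)\<close> to any pair of sufficiently close points (lemma
  \<open>endomorphism_to_nearby_pair\<close>). All classes are then open, and connectedness leaves only one.
  But \<open>\<psi>\<close> is not constant: it is surjective, and \<open>\<Omega>2\<close> is open and nonempty in a space of positive
  dimension.
\<close>

section \<open>Affine endomorphisms of a bounded domain\<close>

lemma norm_vector_scalar_mult:
  fixes v :: "complex ^ 'n"
  shows "norm (c *s v) = cmod c * norm v"
  by (simp add: norm_vec_def L2_set_def norm_mult power_mult_distrib real_sqrt_mult
      flip: sum_distrib_left)

lemma holomorphic_map_on_affine:
  fixes \<Omega> :: "(complex ^ 'n) set" and p v :: "complex ^ 'm"
  shows "holomorphic_map_on \<Omega> (\<lambda>z. p + ((z $ i - c) / d) *s v)"
  unfolding holomorphic_map_on_def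
proof
  fix z :: "complex ^ 'n"
  let ?T = "\<lambda>h::complex ^ 'n. (h $ i / d) *s v"
  have "linear ?T"
    by (rule linearI)
      (simp_all add: vec_eq_iff add_divide_distrib distrib_right
        scaleR_conv_of_real[of _ "x::complex" for x])
  then have "bounded_linear ?T"
    by (rule linear_conv_bounded_linear[THEN iffD1])
  then have "((\<lambda>z. (p - (c / d) *s v) + ?T z) has_derivative (\<lambda>h. 0 + ?T h)) (at z)"
    by (intro has_derivative_add has_derivative_const bounded_linear_imp_has_derivative)
  moreover have "(\<lambda>z. (p - (c / d) *s v) + ?T z) = (\<lambda>z. p + ((z $ i - c) / d) *s v)"
    by (simp add: fun_eq_iff vec_eq_iff diff_divide_distrib left_diff_distrib)
  moreover have "Vector_Spaces.linear (*s) (*s) ?T"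
    by unfold_locales (simp_all add: vec_eq_iff add_divide_distrib distrib_right distrib_left)
  ultimately show "\<exists>f'. ((\<lambda>z. p + ((z $ i - c) / d) *s v) has_derivative f') (at z) \<and>
      Vector_Spaces.linear (*s) (*s) f'"
    by auto
qed

lemma restrict_in_holo_End:
  assumes "open \<Omega>" "holomorphic_map_on \<Omega> f" "\<And>z. z \<in> \<Omega> \<Longrightarrow> f z \<in> \<Omega>"
  shows "restrict f \<Omega> \<in> carrier (holo_End \<Omega>)"
  using holomorphic_map_on_cong[OF assms(1) _ assms(2), of "restrict f \<Omega>"] assms(3)
  by (simp add: holo_End_def)

text \<open>
  For a coordinate \<open>i\<close> with \<open>a $ i \<noteq> b $ i\<close>, the map \<open>z \<mapsto> p + ((z $ i - a $ i) / (b $ i - a $ i)) (q - p)\<close>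
  carries \<open>a\<close> to \<open>p\<close> and \<open>b\<close> to \<open>q\<close>. Boundedness of \<open>\<Omega>\<close> bounds the quotient, so the image stays
  inside a given ball about \<open>p\<close> once \<open>q\<close> is near \<open>p\<close>.
\<close>

lemma endomorphism_to_nearby_pair:
  fixes \<Omega> :: "(complex ^ 'n) set"
  assumes "open \<Omega>" "bounded \<Omega>" "a \<in> \<Omega>" "b \<in> \<Omega>" "a \<noteq> b" "p \<in> \<Omega>"
  shows "\<exists>\<delta>>0. \<forall>q\<in>ball p \<delta>. \<exists>f\<in>carrier (holo_End \<Omega>). f a = p \<and> f b = q"
proof -
  obtain i where i: "a $ i \<noteq> b $ i"
    using \<open>a \<noteq> b\<close> by (auto simp: vec_eq_iff)
  define t where "t z = (z $ i - a $ i) / (b $ i - a $ i)" for z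
  obtain R where R: "\<And>z. z \<in> \<Omega> \<Longrightarrow> norm (z - a) \<le> R"
    using \<open>bounded \<Omega>\<close> by (metis bounded_any_center dist_norm norm_minus_commute)
  \<comment> \<open>The summand 1 makes \<open>M\<close> positive, as the radius \<open>e / M\<close> below requires.\<close>
  define M where "M = \<bar>R\<bar> / cmod (b $ i - a $ i) + 1"
  have "M > 0"
    unfolding M_def by (intro add_nonneg_pos) auto
  have M: "cmod (t z) \<le> M" if "z \<in> \<Omega>" for z
  proof -
    have "cmod (z $ i - a $ i) \<le> \<bar>R\<bar>"
      using R[OF that] Finite_Cartesian_Product.norm_nth_le[of "z - a" i] by simp
    then have "cmod (t z) \<le> \<bar>R\<bar> / cmod (b $ i - a $ i)"
      by (simp add: t_def norm_divide divide_right_mono)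
    then show ?thesis
      by (simp add: M_def)
  qed
  obtain e where "e > 0" and "ball p e \<subseteq> \<Omega>"
    using \<open>open \<Omega>\<close> \<open>p \<in> \<Omega>\<close> open_contains_ball by blast
  then have e: "p + w \<in> \<Omega>" if "norm w < e" for w
    using that by (auto simp: dist_norm intro!: subsetD[OF \<open>ball p e \<subseteq> \<Omega>\<close>])
  have "\<exists>f\<in>carrier (holo_End \<Omega>). f a = p \<and> f b = q" if q: "q \<in> ball p (e / M)" for q
  proof -
    let ?f = "\<lambda>z. p + t z *s (q - p)"
    have "?f z \<in> \<Omega>" if "z \<in> \<Omega>" for z
    proof -
      have "norm (t z *s (q - p)) \<le> M * norm (q - p)"
        unfolding norm_vector_scalar_mult using M[OF that] by (intro mult_right_mono) auto
      also have "\<dots> < e"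
        using q \<open>M > 0\<close> by (simp add: dist_norm norm_minus_commute field_simps)
      finally show ?thesis
        by (rule e)
    qed
    then have "restrict ?f \<Omega> \<in> carrier (holo_End \<Omega>)"
      unfolding t_def by (intro restrict_in_holo_End assms holomorphic_map_on_affine)
    moreover have "restrict ?f \<Omega> a = p" "restrict ?f \<Omega> b = q"
      using assms i by (simp_all add: t_def)
    ultimately show ?thesis
      by blast
  qed
  then show ?thesis
    using \<open>e > 0\<close> \<open>M > 0\<close> by (meson divide_pos_pos)
qed

text \<open>
  One nontrivial identification spreads, by the previous lemma, to all pairs of sufficiently close
  points; so the map is locally constant.
\<close>

lemma invariant_map_injective_or_constant:
  fixes \<Omega> :: "(complex ^ 'n) set"
  assumes \<Omega>: "bounded_domain \<Omega>"
    and invariant: "\<And>f z w. f \<in> carrier (holo_End \<Omega>) \<Longrightarrow> z \<in> \<Omega> \<Longrightarrow> w \<in> \<Omega> \<Longrightarrow> \<psi> z = \<psi> w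
      \<Longrightarrow> \<psi> (f z) = \<psi> (f w)"
  shows "inj_on \<psi> \<Omega> \<or> \<psi> constant_on \<Omega>"
proof (rule disjCI)
  assume "\<not> \<psi> constant_on \<Omega>"
  show "inj_on \<psi> \<Omega>"
  proof (rule inj_onI, rule ccontr)
    fix a b assume ab: "a \<in> \<Omega>" "b \<in> \<Omega>" "\<psi> a = \<psi> b" "a \<noteq> b"
    have "eventually (\<lambda>q. \<psi> p = \<psi> q) (at p within \<Omega>)" if p: "p \<in> \<Omega>" for p
    proof -
      obtain \<delta> where "\<delta> > 0"
        and \<delta>: "\<And>q. q \<in> ball p \<delta> \<Longrightarrow> \<exists>f\<in>carrier (holo_End \<Omega>). f a = p \<and> f b = q"
        using endomorphism_to_nearby_pair[OF _ _ ab(1,2,4) p] \<Omega>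
        unfolding bounded_domain_def by blast
      have "\<psi> p = \<psi> q" if "q \<in> ball p \<delta>" for q
        using \<delta>[OF that] invariant ab by metis
      then show ?thesis
        using \<open>\<delta> > 0\<close> by (auto simp: eventually_at dist_commute)
    qed
    then have "\<psi> constant_on \<Omega>"
      using \<Omega> connected_local_const[of \<Omega> _ _ \<psi>]
      unfolding bounded_domain_def constant_on_def by metis
    with \<open>\<not> \<psi> constant_on \<Omega>\<close> show False ..
  qed
qed

section \<open>Constant endomorphisms\<close>

definition const_map :: "'a set \<Rightarrow> 'a \<Rightarrow> 'a \<Rightarrow> 'a" where
  "const_map \<Omega> w = (\<lambda>z\<in>\<Omega>. w)"

lemma const_map_in_holo_End:
  assumes "open \<Omega>" "w \<in> \<Omega>"
  shows "const_map \<Omega> w \<in> carrier (holo_End \<Omega>)"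
proof -
  have "holomorphic_map_on \<Omega> (\<lambda>_. w)"
    using holomorphic_map_on_affine[where v = 0 and p = w] by simp
  then show ?thesis
    unfolding const_map_def using assms by (intro restrict_in_holo_End) auto
qed

lemma mult_const_map:
  assumes "f \<in> carrier (holo_End \<Omega>)" "w \<in> \<Omega>"
  shows "f \<otimes>\<^bsub>holo_End \<Omega>\<^esub> const_map \<Omega> w = const_map \<Omega> (f w)"
  using assms by (auto simp: holo_End_def compose_def const_map_def fun_eq_iff)

lemma const_map_mult:
  assumes "f \<in> carrier (holo_End \<Omega>)"
  shows "const_map \<Omega> w \<otimes>\<^bsub>holo_End \<Omega>\<^esub> f = const_map \<Omega> w"
  using assms by (auto simp: holo_End_def compose_def const_map_def fun_eq_iff)

lemma const_map_inject:
  assumes "\<Omega> \<noteq> {}" "const_map \<Omega> v = const_map \<Omega> w"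
  shows "v = w"
  using assms by (metis const_map_def ex_in_conv restrict_apply')

text \<open>A left zero \<open>c\<close> satisfies \<open>c = c \<circ> const w = const (c w)\<close> for any point \<open>w\<close>.\<close>

lemma left_zero_imp_const_map:
  assumes "open \<Omega>" "\<Omega> \<noteq> {}" "c \<in> carrier (holo_End \<Omega>)"
    and "\<And>f. f \<in> carrier (holo_End \<Omega>) \<Longrightarrow> c \<otimes>\<^bsub>holo_End \<Omega>\<^esub> f = c"
  shows "\<exists>w\<in>\<Omega>. c = const_map \<Omega> w"
proof -
  obtain w where "w \<in> \<Omega>"
    using assms by blast
  then have "c = const_map \<Omega> (c w)"
    using assms const_map_in_holo_End mult_const_map by metis
  moreover have "c w \<in> \<Omega>"
    using assms(3) \<open>w \<in> \<Omega>\<close> by (auto simp: holo_End_def)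
  ultimately show ?thesis
    by blast
qed

section \<open>Epimorphisms\<close>

text \<open>
  Surjectivity of \<open>\<phi>\<close> is what makes \<open>\<phi> (const z)\<close> a left zero of the whole target semigroup, not
  just of the image.
\<close>

lemma epi_induces_point_map:
  fixes \<Omega>1 :: "(complex ^ 'n) set" and \<Omega>2 :: "(complex ^ 'm) set"
  assumes \<Omega>1: "open \<Omega>1" "\<Omega>1 \<noteq> {}" and \<Omega>2: "open \<Omega>2" "\<Omega>2 \<noteq> {}"
    and \<phi>: "\<phi> \<in> epi (holo_End \<Omega>1) (holo_End \<Omega>2)"
  obtains \<psi> where "\<psi> ` \<Omega>1 = \<Omega>2"
    and "\<And>f z. f \<in> carrier (holo_End \<Omega>1) \<Longrightarrow> z \<in> \<Omega>1 \<Longrightarrow> \<phi> f (\<psi> z) = \<psi> (f z)"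
proof -
  have hom: "\<phi> \<in> hom (holo_End \<Omega>1) (holo_End \<Omega>2)"
    and surj: "\<phi> ` carrier (holo_End \<Omega>1) = carrier (holo_End \<Omega>2)"
    using \<phi> by (auto simp: epi_def)
  note const1 = const_map_in_holo_End[OF \<Omega>1(1)]
  have maps: "f z \<in> \<Omega>1" if "f \<in> carrier (holo_End \<Omega>1)" "z \<in> \<Omega>1" for f z
    using that by (auto simp: holo_End_def)
  have "\<exists>w\<in>\<Omega>2. \<phi> (const_map \<Omega>1 z) = const_map \<Omega>2 w" if z: "z \<in> \<Omega>1" for z
  proof (rule left_zero_imp_const_map[OF \<Omega>2])
    show "\<phi> (const_map \<Omega>1 z) \<in> carrier (holo_End \<Omega>2)"
      using hom_in_carrier[OF hom] const1[OF z] by blast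
    fix g assume "g \<in> carrier (holo_End \<Omega>2)"
    then obtain f where f: "f \<in> carrier (holo_End \<Omega>1)" "g = \<phi> f"
      using surj by blast
    then show "\<phi> (const_map \<Omega>1 z) \<otimes>\<^bsub>holo_End \<Omega>2\<^esub> g = \<phi> (const_map \<Omega>1 z)"
      by (metis hom_mult[OF hom] const1[OF z] const_map_mult)
  qed
  then obtain \<psi> where \<psi>: "\<And>z. z \<in> \<Omega>1 \<Longrightarrow> \<psi> z \<in> \<Omega>2"
    "\<And>z. z \<in> \<Omega>1 \<Longrightarrow> \<phi> (const_map \<Omega>1 z) = const_map \<Omega>2 (\<psi> z)"
    by metis
  have intertwine: "\<phi> f (\<psi> z) = \<psi> (f z)" if f: "f \<in> carrier (holo_End \<Omega>1)" and z: "z \<in> \<Omega>1" for f z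
  proof -
    have "const_map \<Omega>2 (\<phi> f (\<psi> z)) = \<phi> f \<otimes>\<^bsub>holo_End \<Omega>2\<^esub> \<phi> (const_map \<Omega>1 z)"
      using mult_const_map hom_in_carrier[OF hom f] \<psi> z by metis
    also have "\<dots> = \<phi> (const_map \<Omega>1 (f z))"
      by (metis hom_mult[OF hom f const1[OF z]] mult_const_map[OF f z])
    also have "\<dots> = const_map \<Omega>2 (\<psi> (f z))"
      using \<psi> maps f z by blast
    finally show ?thesis
      by (rule const_map_inject[OF \<Omega>2(2)])
  qed
  have "\<Omega>2 \<subseteq> \<psi> ` \<Omega>1"
  proof
    fix w assume w: "w \<in> \<Omega>2"
    obtain f where f: "f \<in> carrier (holo_End \<Omega>1)" "\<phi> f = const_map \<Omega>2 w"
      using surj const_map_in_holo_End[OF \<Omega>2(1) w] by (metis imageE)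
    obtain z where z: "z \<in> \<Omega>1"
      using \<Omega>1 by blast
    have "\<psi> (f z) = w"
      using intertwine[OF f(1) z] f(2) \<psi>(1)[OF z] by (simp add: const_map_def)
    then show "w \<in> \<psi> ` \<Omega>1"
      using maps f z by blast
  qed
  then have "\<psi> ` \<Omega>1 = \<Omega>2"
    using \<psi> by blast
  then show thesis
    using intertwine that by blast
qed

theorem theorem2:
  fixes \<Omega>1 :: "(complex ^ 'n) set"
    and \<Omega>2 :: "(complex ^ 'm) set"
    and \<phi> :: "(complex ^ 'n \<Rightarrow> complex ^ 'n) \<Rightarrow> (complex ^ 'm \<Rightarrow> complex ^ 'm)"
  assumes "bounded_domain \<Omega>1" and "bounded_domain \<Omega>2"
    and "\<phi> \<in> epi (holo_End \<Omega>1) (holo_End \<Omega>2)"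
  shows "\<phi> \<in> iso (holo_End \<Omega>1) (holo_End \<Omega>2)"
proof -
  have \<Omega>: "open \<Omega>1" "\<Omega>1 \<noteq> {}" "open \<Omega>2" "\<Omega>2 \<noteq> {}"
    using assms unfolding bounded_domain_def by auto
  obtain \<psi> where surj: "\<psi> ` \<Omega>1 = \<Omega>2"
    and intertwine: "\<And>f z. f \<in> carrier (holo_End \<Omega>1) \<Longrightarrow> z \<in> \<Omega>1 \<Longrightarrow> \<phi> f (\<psi> z) = \<psi> (f z)"
    using epi_induces_point_map[OF \<Omega> assms(3)] by metis
  have "\<psi> (f z) = \<psi> (f w)"
    if "f \<in> carrier (holo_End \<Omega>1)" "z \<in> \<Omega>1" "w \<in> \<Omega>1" "\<psi> z = \<psi> w" for f z w
    using that intertwine by metis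
  then have "inj_on \<psi> \<Omega>1 \<or> \<psi> constant_on \<Omega>1"
    by (rule invariant_map_injective_or_constant[OF assms(1)])
  moreover have "\<not> \<psi> constant_on \<Omega>1"
  proof
    assume "\<psi> constant_on \<Omega>1"
    then obtain w where "\<And>z. z \<in> \<Omega>1 \<Longrightarrow> \<psi> z = w"
      by (auto simp: constant_on_def)
    then have "\<Omega>2 = {w}"
      using surj \<Omega>(2) by blast
    then show False
      using \<Omega>(3) not_open_singleton by metis
  qed
  ultimately have inj: "inj_on \<psi> \<Omega>1"
    by blast
  have "inj_on \<phi> (carrier (holo_End \<Omega>1))"
  proof (rule inj_onI)
    fix f g assume f: "f \<in> carrier (holo_End \<Omega>1)" and g: "g \<in> carrier (holo_End \<Omega>1)"
      and eq: "\<phi> f = \<phi> g"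
    have ext: "f \<in> \<Omega>1 \<rightarrow>\<^sub>E \<Omega>1" "g \<in> \<Omega>1 \<rightarrow>\<^sub>E \<Omega>1"
      using f g by (auto simp: holo_End_def)
    show "f = g"
    proof (rule PiE_ext[OF ext])
      fix z assume z: "z \<in> \<Omega>1"
      have "\<psi> (f z) = \<psi> (g z)"
        using intertwine[OF f z] intertwine[OF g z] eq by simp
      then show "f z = g z"
        using inj ext z by (auto dest: inj_onD)
    qed
  qed
  then show ?thesis
    using assms(3) by (auto simp: epi_def iso_def bij_betw_def)
qed

end
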